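(* Consider a connected undirected network $G=(V,E)$ of $N$ nodes with system dynamics $$x_i[k+1]=x_i[k]+\varepsilon\sum_{v_j\in N_i}a_{ij}^{(k)}\,(x_j[k]-x_i[k]),\qquad k\ge 0,$$ and assume that all nodes follow the confidential interaction protocol. Let Eve be an honest-but-curious node, let Alice be a neighbor of Eve, and suppose that Alice is also connected to (i.e. is a neighbor of) another, legitimate node Bob. Then Eve cannot learn the initial state $x_A[0]$ of Alice: the privacy of $x_A[0]$ is preserved against Eve.
   Context: $N_i=\{v_j:(v_i,v_j)\in E\}$ is the neighbor set of $v_i$ (no self-loops), $\Delta=\max_i|N_i|$, $\varepsilon>0$ is a constant step size, and states are real numbers. Subscripts $A,B,E$ stand for Alice, Bob, Eve (three distinct nodes). Confidential interaction protocol: for every edge $(v_i,v_j)$ and every $k\ge0$, $a_{ij}^{(k)}=a_{ji}^{(k)}=a_{i\to j}^{(k)}a_{j\to i}^{(k)}$, where $a_{i\to j}^{(k)}$ is chosen by and known only to $v_i$, and $a_{j\to i}^{(k)}$ is chosen by and known only to $v_j$. For $k=0$ each $a_{i\to j}^{(0)}$ may be any real number; for $k\ge1$ each $a_{i\to j}^{(k)}$ lies in a fixed range $[\underline a,\bar a]$ with $0<\underline a<\bar a<1/\sqrt{\varepsilon\Delta}$. Through encrypted exchanges, node $v_i$ obtains from each neighbor $v_j$ exactly the quantity $a_{j\to i}^{(k)}(x_j[k]-x_i[k])$, and multiplies it by its own $a_{i\to j}^{(k)}$ to get $\Delta x_{ij}[k]=a_{ij}^{(k)}(x_j[k]-x_i[k])$.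 Ciphertexts encrypted under another node's key (semantically secure Paillier encryption) are treated as giving no information. An honest-but-curious node follows the protocol but tries to infer other nodes' states from what it sees; a legitimate node follows the protocol and makes no attempt to infer other nodes' states (in particular it shares nothing with Eve). An execution consists of real initial states $x_i[0]$ for all nodes $v_i$ and weights $a_{i\to j}^{(k)}$ for all edges $(v_i,v_j)$ (in both directions) and all $k\ge0$, such that each $a_{i\to j}^{(0)}$ is an arbitrary real number and each $a_{i\to j}^{(k)}$ with $k\ge1$ lies in $[\underline a,\bar a]$, where $0<\underline a<\bar a<1/\sqrt{\varepsilon\Delta}$; the coupling weights are then $a_{ij}^{(k)}=a_{ji}^{(k)}=a_{i\to j}^{(k)}a_{j\to i}^{(k)}$. The information accessible to Eve in an execution consists, over all $k\ge0$, of her state $x_E[k]$, her own weights $a_{E\to j}^{(k)}$, and the received weighted differences, equivalently $a_{j\to E}^{(k)}(x_j[k]-x_E[k])$ and $\Delta x_{Ej}[k]$, for all her neighbors $v_j$. Privacy definition: the privacy of $x_A[0]$ is preserved against Eve if Eve cannot estimate $x_A[0]$ with any accuracy, i.e. she cannot find even a finite range (finite lower and upper bounds) for $x_A[0]$. Precisely: for every execution there is no bounded interval $[L,U]$ such that every execution on the same graph (with the same $\varepsilon,\underline a,\bar a$) in which the information accessible to Eve is the same has Alice's initial state in $[L,U]$. *)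

theory Defs
  imports Complex_Main "HOL-Library.FuncSet" "Graph_Theory.Digraph_Component"
begin

definition neighbors :: "'v pair_pre_digraph \<Rightarrow> 'v \<Rightarrow> 'v set" where
  "neighbors G i = {j. (i, j) \<in> parcs G}"

definition max_degree :: "'v pair_pre_digraph \<Rightarrow> nat" where
  "max_degree G = Max ((\<lambda>i. card (neighbors G i)) ` pverts G)"

(* half_weight e k i j is the factor a_{i -> j}^(k), chosen by and known only to node i.
   Values at non-vertices and non-edges are irrelevant: nothing below reads them. *)
record 'v execution =
  init_state :: "'v \<Rightarrow> real"
  half_weight :: "nat \<Rightarrow> 'v \<Rightarrow> 'v \<Rightarrow> real"

definition coupling :: "'v execution \<Rightarrow> nat \<Rightarrow> 'v \<Rightarrow> 'v \<Rightarrow> real" where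
  "coupling e k i j = half_weight e k i j * half_weight e k j i"

primrec state :: "'v pair_pre_digraph \<Rightarrow> real \<Rightarrow> 'v execution \<Rightarrow> nat \<Rightarrow> 'v \<Rightarrow> real" where
  "state G \<epsilon> e 0 = init_state e"
| "state G \<epsilon> e (Suc k) = (\<lambda>i. state G \<epsilon> e k i +
      \<epsilon> * (\<Sum>j\<in>neighbors G i. coupling e k i j * (state G \<epsilon> e k j - state G \<epsilon> e k i)))"

(* The range is imposed from k = 1 on; at k = 0 the weights are arbitrary reals. *)
definition executions :: "'v pair_pre_digraph \<Rightarrow> real \<Rightarrow> real \<Rightarrow> 'v execution set" where
  "executions G a_lo a_hi =
     {e. \<forall>k\<ge>1. \<forall>(i, j)\<in>parcs G. half_weight e k i j \<in> {a_lo..a_hi}}"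

(* What node v sees at each step k: its own state and, for each neighbor j, its own factor
   a_{v -> j}^(k), the received quantity a_{j -> v}^(k) (x_j[k] - x_v[k]), and their product
   a_{vj}^(k) (x_j[k] - x_v[k]).  The restriction to the neighbors makes equality of views
   mean agreement on exactly these quantities. *)
definition view ::
  "'v pair_pre_digraph \<Rightarrow> real \<Rightarrow> 'v \<Rightarrow> 'v execution \<Rightarrow> nat \<Rightarrow> real \<times> ('v \<Rightarrow> real \<times> real \<times> real)" where
  "view G \<epsilon> v e k =
     (state G \<epsilon> e k v,
      (\<lambda>j\<in>neighbors G v.
         (half_weight e k v j,
          half_weight e k j v * (state G \<epsilon> e k j - state G \<epsilon> e k v),
          coupling e k v j * (state G \<epsilon> e k j - state G \<epsilon> e k v))))"

definition privacy_preserved ::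
  "'v pair_pre_digraph \<Rightarrow> real \<Rightarrow> real \<Rightarrow> real \<Rightarrow> 'v \<Rightarrow> 'v \<Rightarrow> bool" where
  "privacy_preserved G \<epsilon> a_lo a_hi u v \<longleftrightarrow>
     (\<forall>e\<in>executions G a_lo a_hi.
        \<not> (\<exists>L U. \<forall>e'\<in>executions G a_lo a_hi.
               view G \<epsilon> v e' = view G \<epsilon> v e \<longrightarrow> init_state e' u \<in> {L..U}))"

end

theory Submission
  imports Defs
begin

text \<open>
  Move mass \<open>d\<close> from Bob to Alice at time 0 and let the edge between them carry it back in the
  first step: if the flow \<open>a\<^bsub>AB\<^esub> (x\<^sub>B - x\<^sub>A)\<close> is lowered by \<open>d / \<epsilon>\<close> and every other flow
  is unchanged, all states agree from step 1 on. Since the weights at step 0 are unconstrained,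
  Alice and Bob can produce these flows by rescaling only their own factors, as soon as their new
  states differ from all other states; this holds for every sufficiently large \<open>d\<close>. Eve sees no
  difference, whereas Alice's initial state is arbitrarily large.
\<close>

definition shift_init :: "'v \<Rightarrow> 'v \<Rightarrow> real \<Rightarrow> ('v \<Rightarrow> real) \<Rightarrow> 'v \<Rightarrow> real" where
  "shift_init A B d x = x(A := x A + d, B := x B - d)"

text \<open>Bob's factor towards Alice is normalised to 1, so Alice's factor alone is their whole
  coupling and solves the equation for the prescribed flow. Towards any other node, Alice and Bob
  rescale their factors to undo the change in the state difference.\<close>

definition shift_weight ::
  "real \<Rightarrow> 'v \<Rightarrow> 'v \<Rightarrow> real \<Rightarrow> 'v execution \<Rightarrow> 'v \<Rightarrow> 'v \<Rightarrow> real" where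
  "shift_weight \<epsilon> A B d e i j =
     (let x = init_state e; y = shift_init A B d x in
      if i = A \<and> j = B then (coupling e 0 A B * (x B - x A) - d / \<epsilon>) / (y B - y A)
      else if i = B \<and> j = A then 1
      else if i \<in> {A, B} then half_weight e 0 i j * (x i - x j) / (y i - y j)
      else half_weight e 0 i j)"

definition shift_execution ::
  "real \<Rightarrow> 'v \<Rightarrow> 'v \<Rightarrow> real \<Rightarrow> 'v execution \<Rightarrow> 'v execution" where
  "shift_execution \<epsilon> A B d e =
     \<lparr>init_state = shift_init A B d (init_state e),
      half_weight = (\<lambda>k. if k = 0 then shift_weight \<epsilon> A B d e else half_weight e k)\<rparr>"

text \<open>The dynamics have no memory: each state depends only on the previous state and the
  current weights. The initial states may therefore differ.\<close>

lemma state_Suc_cong: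
  assumes "\<And>k. k \<ge> 1 \<Longrightarrow> half_weight e' k = half_weight e k"
    and "state G \<epsilon> e' 1 = state G \<epsilon> e 1"
  shows "state G \<epsilon> e' (Suc k) = state G \<epsilon> e (Suc k)"
proof (induction k)
  case 0
  then show ?case using assms(2) by simp
next
  case (Suc k)
  have "coupling e' (Suc k) = coupling e (Suc k)"
    using assms(1)[of "Suc k"] by (intro ext) (simp add: coupling_def)
  then show ?case
    by (subst (1 2) state.simps(2)) (simp only: Suc.IH)
qed

lemma shift_execution_in_executions:
  assumes "e \<in> executions G a_lo a_hi"
  shows "shift_execution \<epsilon> A B d e \<in> executions G a_lo a_hi"
  using assms by (fastforce simp: executions_def shift_execution_def)

text \<open>The assumption \<open>sep\<close> keeps every denominator in \<open>shift_weight\<close>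
  nonzero when the other endpoint is a vertex.\<close>

context
  fixes G :: "'v pair_pre_digraph" and \<epsilon> d :: real and A B :: 'v and e :: "'v execution"
  assumes G: "pair_graph G" and eps: "\<epsilon> > 0" and AB: "A \<noteq> B"
    and B_nbr: "B \<in> neighbors G A"
    and sep: "\<And>i j. \<lbrakk>i \<in> {A, B}; j \<in> pverts G; j \<noteq> i\<rbrakk> \<Longrightarrow>
      shift_init A B d (init_state e) j \<noteq> shift_init A B d (init_state e) i"
begin

interpretation pair_graph G by (rule G)

lemma B_vert: "B \<in> pverts G" and A_nbr: "A \<in> neighbors G B"
  using B_nbr by (auto simp: neighbors_def in_arcsD2 arcs_symmetric)

lemma finite_neighbors: "finite (neighbors G i)"
  by (rule finite_subset[OF _ pair_finite_verts]) (auto simp: neighbors_def in_arcsD2)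

text \<open>If \<open>j\<close> is Alice or Bob, the rescaling cancels the new difference, which is
  nonzero by \<open>sep\<close>; otherwise neither state nor factor has changed. For Eve as
  \<open>v\<close> this is what she receives at step 0.\<close>

lemma shift_view_weight:
  assumes "v \<notin> {A, B}" and "v \<in> pverts G"
  shows "shift_weight \<epsilon> A B d e j v *
           (shift_init A B d (init_state e) j - shift_init A B d (init_state e) v) =
         half_weight e 0 j v * (init_state e j - init_state e v)"
  using assms sep[of j v]
  by (auto simp: shift_weight_def Let_def) (auto simp: shift_init_def)

lemma shift_flow:
  assumes "(i, j) \<in> parcs G"
  shows "coupling (shift_execution \<epsilon> A B d e) 0 i j *
           (shift_init A B d (init_state e) j - shift_init A B d (init_state e) i) =
         coupling e 0 i j * (init_state e j - init_state e i) +
           (if i = A \<and> j = B then - d / \<epsilon> else if i = B \<and> j = A then d / \<epsilon> else 0)"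
proof -
  let ?x = "init_state e" and ?y = "shift_init A B d (init_state e)"
  let ?w = "half_weight e 0" and ?w' = "shift_weight \<epsilon> A B d e"
  have verts: "i \<in> pverts G" "j \<in> pverts G" and "i \<noteq> j"
    using assms no_loops' by (auto dest: in_arcsD1 in_arcsD2)
  have "?y B - ?y A \<noteq> 0"
    using sep[of A B] B_vert AB by auto
  then have AB_flow: "?w' A B * ?w' B A * (?y B - ?y A) = ?w A B * ?w B A * (?x B - ?x A) - d / \<epsilon>"
    using AB by (simp add: shift_weight_def Let_def coupling_def)
  \<comment> \<open>Without loops, every edge other than the one between Alice and Bob has an
    endpoint outside \<open>{A, B}\<close>. That endpoint keeps its own factor, and
    \<open>shift_view_weight\<close> handles the remaining product.\<close>
  consider "i = A" "j = B" | "i = B" "j = A" | "i \<notin> {A, B}" | "j \<notin> {A, B}"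
    using \<open>i \<noteq> j\<close> by auto
  then show ?thesis
  proof cases
    case 1
    then show ?thesis using AB_flow AB by (simp add: coupling_def shift_execution_def)
  next
    case 2
    then show ?thesis using AB_flow AB
      by (simp add: coupling_def shift_execution_def algebra_simps)
  next
    case 3
    then have "?w' i j = ?w i j" by (auto simp: shift_weight_def)
    with 3 show ?thesis using shift_view_weight[OF 3 verts(1), of j]
      by (auto simp: coupling_def shift_execution_def mult.assoc)
  next
    case 4
    then have "?w' j i = ?w j i" by (auto simp: shift_weight_def)
    moreover have "?w' i j * (?y j - ?y i) = ?w i j * (?x j - ?x i)"
      using shift_view_weight[OF 4 verts(2), of i] by (simp add: algebra_simps)
    ultimately show ?thesis using 4
      by (auto simp: coupling_def shift_execution_def mult.assoc mult.left_commute)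
  qed
qed

text \<open>Multiplied by \<open>\<epsilon>\<close>, the changes in flow add up to
  \<open>- d\<close> at Alice, \<open>d\<close> at Bob and 0 elsewhere, which cancels the shift of
  the initial states.\<close>

lemma shift_state_1: "state G \<epsilon> (shift_execution \<epsilon> A B d e) 1 = state G \<epsilon> e 1"
proof
  fix i
  let ?x = "init_state e" and ?y = "shift_init A B d (init_state e)"
  let ?c = "\<lambda>j. if i = A \<and> j = B then - d / \<epsilon> else if i = B \<and> j = A then d / \<epsilon> else 0"
  have "(\<Sum>j\<in>neighbors G i. coupling (shift_execution \<epsilon> A B d e) 0 i j * (?y j - ?y i)) =
      (\<Sum>j\<in>neighbors G i. coupling e 0 i j * (?x j - ?x i)) + (\<Sum>j\<in>neighbors G i. ?c j)"
    unfolding sum.distrib[symmetric]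
    by (intro sum.cong refl shift_flow) (simp add: neighbors_def)
  moreover have "?y i + \<epsilon> * (\<Sum>j\<in>neighbors G i. ?c j) = ?x i"
  proof -
    \<comment> \<open>Each summand is supported at a single \<open>j\<close>, so
      \<open>sum.delta\<close> evaluates its sum.\<close>
    have "?c j = (if j = B then if i = A then - d / \<epsilon> else 0 else 0) +
        (if j = A then if i = B then d / \<epsilon> else 0 else 0)" for j
      using AB by auto
    then show ?thesis
      using AB eps B_nbr A_nbr
      by (simp add: shift_init_def sum.distrib sum.delta finite_neighbors)
  qed
  ultimately show "state G \<epsilon> (shift_execution \<epsilon> A B d e) 1 i = state G \<epsilon> e 1 i"
    by (simp add: shift_execution_def distrib_left)
qed

lemma shift_view:
  assumes "v \<notin> {A, B}" and "v \<in> pverts G"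
  shows "view G \<epsilon> v (shift_execution \<epsilon> A B d e) = view G \<epsilon> v e"
proof
  fix k
  let ?e = "shift_execution \<epsilon> A B d e"
  show "view G \<epsilon> v ?e k = view G \<epsilon> v e k"
  proof (cases k)
    case 0
    have "half_weight ?e 0 v j = half_weight e 0 v j" for j
      using assms(1) by (simp add: shift_execution_def shift_weight_def)
    moreover have "half_weight ?e 0 j v * (init_state ?e j - init_state ?e v) =
        half_weight e 0 j v * (init_state e j - init_state e v)" for j
      using shift_view_weight[OF assms] by (simp add: shift_execution_def)
    moreover have "init_state ?e v = init_state e v"
      using assms(1) by (simp add: shift_execution_def shift_init_def)
    ultimately show ?thesis
      by (simp add: 0 view_def coupling_def mult.assoc)
  next
    case (Suc m)
    have weights: "half_weight ?e k = half_weight e k" if "k \<ge> 1" for k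
      using that by (simp add: shift_execution_def)
    have "state G \<epsilon> ?e k = state G \<epsilon> e k"
      unfolding Suc by (rule state_Suc_cong[OF weights shift_state_1])
    moreover have "half_weight ?e k = half_weight e k"
      using weights Suc by simp
    ultimately show ?thesis by (simp add: view_def coupling_def)
  qed
qed

end

text \<open>Any two original values on \<open>V\<close> differ by at most twice the sum of absolute
  values, which is less than \<open>d\<close>, whereas a coincidence would need a difference of size
  \<open>d\<close> or \<open>2 * d\<close>.\<close>

lemma shift_init_separates:
  assumes "finite V" "A \<in> V" "B \<in> V" "A \<noteq> B" and "d > 2 * (\<Sum>v\<in>V. \<bar>x v\<bar>)"
    and "i \<in> {A, B}" "j \<in> V" "j \<noteq> i"
  shows "shift_init A B d x j \<noteq> shift_init A B d x i"
proof -
  have "\<bar>x v\<bar> \<le> (\<Sum>v\<in>V. \<bar>x v\<bar>)" if "v \<in> V" for v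
    using that assms(1) by (intro member_le_sum) auto
  from this[OF assms(2)] this[OF assms(3)] this[OF assms(7)] assms(4-8)
  show ?thesis by (auto simp: shift_init_def)
qed

theorem theorem3:
  fixes G :: "'v pair_pre_digraph"
    and \<epsilon> a_lo a_hi :: real
    and Alice Bob Eve :: 'v
  assumes "pair_graph G"
    and "Digraph_Component.connected (with_proj G)"
    and "\<epsilon> > 0"
    and "0 < a_lo" and "a_lo < a_hi" and "a_hi < 1 / sqrt (\<epsilon> * real (max_degree G))"
    and "distinct [Alice, Bob, Eve]"
    and "Alice \<in> neighbors G Eve"
    and "Bob \<in> neighbors G Alice"
  shows "privacy_preserved G \<epsilon> a_lo a_hi Alice Eve"
  unfolding privacy_preserved_def
proof (intro ballI notI, elim exE)
  fix e L U
  assume e: "e \<in> executions G a_lo a_hi"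
    and bound: "\<forall>e'\<in>executions G a_lo a_hi.
      view G \<epsilon> Eve e' = view G \<epsilon> Eve e \<longrightarrow> init_state e' Alice \<in> {L..U}"
  interpret pair_graph G by fact
  have verts: "Alice \<in> pverts G" "Bob \<in> pverts G" "Eve \<in> pverts G"
    using assms(8,9) by (auto simp: neighbors_def dest: in_arcsD1 in_arcsD2)
  define x where "x = init_state e"
  \<comment> \<open>Twice the sum separates the states. Since \<open>x Alice\<close> is at least
    minus the sum, the rest pushes \<open>x Alice + d\<close> above \<open>U\<close>.\<close>
  define d where "d = 2 * (\<Sum>v\<in>pverts G. \<bar>x v\<bar>) + \<bar>U\<bar> + 1"
  let ?e = "shift_execution \<epsilon> Alice Bob d e"
  have "view G \<epsilon> Eve ?e = view G \<epsilon> Eve e"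
  proof (rule shift_view)
    fix i j assume "i \<in> {Alice, Bob}" "j \<in> pverts G" "j \<noteq> i"
    then show "shift_init Alice Bob d (init_state e) j \<noteq> shift_init Alice Bob d (init_state e) i"
      using verts assms(7)
      by (intro shift_init_separates[of "pverts G"]) (auto simp: d_def x_def)
  qed (use assms verts in auto)
  then have "init_state ?e Alice \<le> U"
    using bound shift_execution_in_executions[OF e] by auto
  then have "x Alice + d \<le> U"
    using assms(7) by (simp add: shift_execution_def shift_init_def x_def)
  moreover have "\<bar>x Alice\<bar> \<le> (\<Sum>v\<in>pverts G. \<bar>x v\<bar>)"
    using verts by (intro member_le_sum) auto
  ultimately show False by (simp add: d_def)
qed

end
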